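(* Let $n\geq 2$ be an integer. Then, as polynomial identities in $x$, $$\sum_{k=1}^{n-1}\frac{B_k(x)B_{n-k}(x)}{k(n-k)}-2\sum_{l=2}^n\binom{n-1}{l-1}\frac{B_lB_{n-l}(x)}{l^2}=\frac{2}{n}H_{n-1}B_n(x)$$ and $$\sum_{k=0}^nB_k(x)B_{n-k}(x)-2\sum_{l=2}^n\binom{n+1}{l+1}\frac{B_lB_{n-l}(x)}{l+2}=(n+1)B_n(x).$$
   Context: The Bernoulli numbers $B_0,B_1,\ldots$ are defined by $\frac{z}{e^z-1}=\sum_{n=0}^{\infty}B_n\frac{z^n}{n!}$ for $|z|<2\pi$ (so $B_1=-1/2$). The Bernoulli polynomials are $B_n(x)=\sum_{k=0}^n\binom{n}{k}B_kx^{n-k}$ for $n=0,1,2,\ldots$; here $B_l$ without an argument denotes the Bernoulli number. For a positive integer $n$, $H_n=1+\frac12+\cdots+\frac1n$. *)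

theory Defs
  imports "HOL-Complex_Analysis.Complex_Analysis"
begin

text \<open>
  The generating function is read as a formal power series; since the divisor has
  subdegree 1, this is division by \<open>(e\<^sup>z - 1)/z\<close>, which is invertible. The analytic form,
  valid for \<open>|z| < 2\<pi>\<close>, is the theorem \<open>bernoulli_sums\<close> below, which determines
  the numbers uniquely.
\<close>
definition bernoulli_number :: "nat \<Rightarrow> real" where
  "bernoulli_number n = fact n * fps_nth (fps_X / (fps_exp 1 - 1)) n"

definition bernoulli_poly :: "nat \<Rightarrow> real poly" where
  "bernoulli_poly n =
     (\<Sum>k=0..n. monom (of_nat (n choose k) * bernoulli_number k) (n - k))"

lemma poly_bernoulli_poly:
  "poly (bernoulli_poly n) x =
     (\<Sum>k=0..n. of_nat (n choose k) * bernoulli_number k * x ^ (n - k))"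
  by (simp add: bernoulli_poly_def poly_sum poly_monom)

lemma subdegree_fps_exp_minus_1: "subdegree (fps_exp 1 - 1 :: 'a :: field_char_0 fps) = 1"
  by (rule subdegreeI) auto

lemma fps_exp_minus_1_nonzero: "fps_exp 1 - 1 \<noteq> (0 :: 'a :: field_char_0 fps)"
  using subdegree_fps_exp_minus_1[where 'a = 'a] by auto

lemma complex_bernoulli_number:
  "complex_of_real (bernoulli_number n) / fact n = fps_nth (fps_X / (fps_exp 1 - 1)) n"
proof -
  define F :: "real fps" where "F = fps_X / (fps_exp 1 - 1)"
  define G :: "complex fps" where "G = Abs_fps (\<lambda>n. of_real (fps_nth F n))"
  have F: "F * (fps_exp 1 - 1) = fps_X"
    unfolding F_def by (intro dvd_div_mult_self, subst fps_dvd_iff)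
      (simp_all only: fps_exp_minus_1_nonzero subdegree_fps_exp_minus_1 fps_X_neq_zero subdegree_fps_X not_False_eq_True)
  have "G * (fps_exp 1 - 1) = fps_X"
  proof (rule fps_ext)
    fix n
    have "fps_nth (G * (fps_exp 1 - 1)) n = of_real (fps_nth (F * (fps_exp 1 - 1)) n)"
      by (auto simp: fps_mult_nth G_def intro!: sum.cong)
    also have "\<dots> = fps_nth fps_X n"
      by (simp add: F fps_X_def)
    finally show "fps_nth (G * (fps_exp 1 - 1)) n = fps_nth fps_X n" .
  qed
  hence "fps_X / (fps_exp 1 - 1) = G"
    using fps_exp_minus_1_nonzero[where 'a = complex] by (metis nonzero_mult_div_cancel_right)
  thus ?thesis
    by (simp add: G_def bernoulli_number_def F_def)
qed

theorem bernoulli_sums: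
  fixes z :: complex
  assumes "norm z < 2 * pi"
  shows "(\<lambda>n. of_real (bernoulli_number n) * z ^ n / fact n) sums
           (if z = 0 then 1 else z / (exp z - 1))"
proof -
  define D :: "complex fps" where "D = fps_exp 1 - 1"
  have rD: "fps_conv_radius D = \<infinity>"
    using fps_conv_radius_diff[of "fps_exp (1::complex)" 1] by (simp add: D_def)
  have eD: "eval_fps D w = exp w - 1" for w
    by (simp add: D_def eval_fps_diff)
  have nz: "eval_fps D w \<noteq> 0" if "w \<in> eball 0 (ereal (2 * pi))" "w \<noteq> 0" for w
  proof
    assume "eval_fps D w = 0"
    hence "exp w = 1" by (simp add: eD)
    then obtain k :: int where k: "Re w = 0" "Im w = of_int (2 * k) * pi"
      by (auto simp: exp_eq_1)
    have "norm w = 2 * pi * \<bar>of_int k\<bar>"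
      using k by (simp add: cmod_def abs_mult)
    moreover have "norm w < 2 * pi" using that by simp
    ultimately have "\<bar>of_int k :: real\<bar> < 1" by simp
    hence "k = 0" by linarith
    with k that show False by (simp add: complex_eq_iff)
  qed
  have D1: "subdegree D = 1" "fps_nth D 1 = 1" "D \<noteq> 0"
    using subdegree_fps_exp_minus_1[where 'a = complex] by (auto simp: D_def)
  have Min: "Min {ereal (2 * pi), fps_conv_radius fps_X, fps_conv_radius D} = ereal (2 * pi)"
    by (simp add: rD)
  have pos: "0 < ereal (2 * pi)" by simp
  have r: "ereal (2 * pi) \<le> fps_conv_radius (fps_X / D)"
    using fps_conv_radius_divide[of D fps_X "ereal (2 * pi)", OF _ _ _ pos nz] D1 Min
    by (simp add: rD)
  have e: "eval_fps (fps_X / D) z = (if z = 0 then 1 else z / (exp z - 1))"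
    using eval_fps_divide[of D fps_X "ereal (2 * pi)" z 1, OF _ _ _ pos nz] D1 Min assms
    by (simp add: rD eD)
  have "(\<lambda>n. fps_nth (fps_X / D) n * z ^ n) sums eval_fps (fps_X / D) z"
    using r assms by (intro sums_eval_fps) (auto intro: less_le_trans[of _ "ereal (2 * pi)"])
  moreover have "fps_nth (fps_X / D) n * z ^ n = of_real (bernoulli_number n) * z ^ n / fact n" for n
    unfolding D_def complex_bernoulli_number[symmetric] by simp
  ultimately show ?thesis
    by (simp add: e)
qed

end

theory Submission
  imports Defs
begin

text \<open>
  Write \<open>f s = 1 / (e\<^sup>s - 1)\<close>. Both identities come from the addition formula
  \<open>f s * f t = f (s + t) * (1 + f s + f t)\<close>. Multiplied by \<open>s * t * e^(x * (s + t))\<close> and read at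
  \<open>s = u * z\<close>, \<open>t = v * z\<close> with \<open>u + v = 1\<close>, it becomes an identity between exponential
  generating functions of Bernoulli polynomials and numbers (lemma \<open>bernoulli_fps_addition\<close>).
  Comparing coefficients of \<open>z\<^sup>n\<close> gives (lemma \<open>bernoulli_poly_convolution\<close>)
  \[ \sum_{k=0}^n {n \choose k} u^k v^{n-k} B_k(x) B_{n-k}(x)
      = B_n(x) + \sum_{l=2}^n {n \choose l} B_l B_{n-l}(x) (v u^l + u v^l). \]

  Integrating over \<open>u \<in> [0, 1]\<close>, with \<open>v = 1 - u\<close>, turns the monomials into Beta integrals, and
  \<open>n + 1\<close> times the result is the second identity. For the first, the terms \<open>k = 0\<close> and \<open>k = n\<close>
  are moved to the right, everything is divided by \<open>u * v\<close>, and only then integrated. The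
  coefficient of \<open>B\<^sub>n(x)\<close> before integration is \<open>(1 - u\<^sup>n - v\<^sup>n) / (u * v) = (\<Sum>i<n-1. u\<^sup>i + v\<^sup>i)\<close>, whose
  integral is twice the harmonic number \<open>H\<^bsub>n-1\<^esub>\<close>; dividing by \<open>n\<close> gives the first identity.
\<close>

section \<open>Generating functions\<close>

text \<open>The exponential generating function \<open>z / (e\<^sup>z - 1)\<close> of the Bernoulli numbers.\<close>
definition bernoulli_fps :: "real fps" where
  "bernoulli_fps = fps_X / (fps_exp 1 - 1)"

lemma fps_nth_bernoulli_fps: "fps_nth bernoulli_fps n = bernoulli_number n / fact n"
  by (simp add: bernoulli_fps_def bernoulli_number_def)

lemma bernoulli_fps_mult: "bernoulli_fps * (fps_exp 1 - 1) = fps_X"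
  unfolding bernoulli_fps_def
  by (intro dvd_div_mult_self, subst fps_dvd_iff)
    (simp_all only: fps_exp_minus_1_nonzero subdegree_fps_exp_minus_1 fps_X_neq_zero
      subdegree_fps_X not_False_eq_True)

lemma bernoulli_number_0: "bernoulli_number 0 = 1"
  using arg_cong[OF bernoulli_fps_mult, of "\<lambda>f. fps_nth f 1"]
  by (simp add: fps_mult_nth fps_nth_bernoulli_fps)

lemma bernoulli_number_1: "bernoulli_number 1 = - 1 / 2"
proof -
  have "{0..2::nat} = {0, 1, 2}" by auto
  thus ?thesis
    using arg_cong[OF bernoulli_fps_mult, of "\<lambda>f. fps_nth f 2"]
    by (simp add: fps_mult_nth fps_nth_bernoulli_fps bernoulli_number_0 fps_X_def fact_numeral)
qed

lemma bernoulli_poly_0: "bernoulli_poly 0 = 1"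
  by (simp add: bernoulli_poly_def bernoulli_number_0 monom_0 one_pCons)

lemma bernoulli_poly_egf:
  "Abs_fps (\<lambda>n. poly (bernoulli_poly n) x / fact n) = bernoulli_fps * fps_exp x"
proof (rule fps_ext)
  fix n
  show "fps_nth (Abs_fps (\<lambda>n. poly (bernoulli_poly n) x / fact n)) n
      = fps_nth (bernoulli_fps * fps_exp x) n"
    by (auto simp: fps_mult_nth fps_nth_bernoulli_fps poly_bernoulli_poly binomial_fact
        sum_divide_distrib intro!: sum.cong)
qed

lemma fps_exp_minus_1_neq_0:
  assumes "c \<noteq> (0::real)"
  shows "fps_exp c - 1 \<noteq> 0"
proof
  assume "fps_exp c - 1 = 0"
  hence "fps_nth (fps_exp c - 1) 1 = 0" by simp
  thus False using assms by simp
qed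

text \<open>
  The addition formula for \<open>1 / (e\<^sup>s - 1)\<close> in terms of \<open>s / (e\<^sup>s - 1)\<close>, with
  \<open>s = u z\<close>, \<open>t = v z\<close> and \<open>s + t = z\<close>. It holds because both sides agree after multiplication by
  \<open>(e\<^sup>s - 1) (e\<^sup>t - 1) (e\<^sup>z - 1)\<close>.
\<close>
lemma bernoulli_fps_addition:
  fixes u v :: real
  assumes "u + v = 1" "u \<noteq> 0" "v \<noteq> 0"
  defines "A \<equiv> bernoulli_fps oo (fps_const u * fps_X)"
    and "C \<equiv> bernoulli_fps oo (fps_const v * fps_X)"
  shows "A * C = bernoulli_fps * (fps_const v * A + fps_const u * C + fps_const (u * v) * fps_X)"
proof -
  define P Q R where "P = fps_exp u - 1" and "Q = fps_exp v - 1" and "R = fps_exp (1::real) - 1"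
  have scaled: "(bernoulli_fps oo (fps_const c * fps_X)) * (fps_exp c - 1) = fps_const c * fps_X" for c
    using arg_cong[OF bernoulli_fps_mult, of "\<lambda>f. f oo (fps_const c * fps_X)"]
    by (simp add: fps_compose_mult_distrib fps_compose_sub_distrib)
  have A: "A * P = fps_const u * fps_X" and C: "C * Q = fps_const v * fps_X"
    and B: "bernoulli_fps * R = fps_X"
    using scaled bernoulli_fps_mult by (simp_all add: A_def C_def P_def Q_def R_def)
  have R: "R = P * Q + P + Q"
    using assms(1) fps_exp_add_mult[of u v] by (simp add: P_def Q_def R_def algebra_simps)
  define a b where "a = fps_const u" and "b = fps_const v"
  have "(A * C) * (P * Q * R) = (A * P) * (C * Q) * R"
    by (simp add: algebra_simps)
  also have "\<dots> = fps_X * (a * b * fps_X * R)"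
    by (simp add: A C a_def b_def algebra_simps flip: fps_const_mult)
  also have "a * b * fps_X * R = b * (a * fps_X) * Q + a * (b * fps_X) * P + a * b * fps_X * (P * Q)"
    by (simp add: R algebra_simps)
  also have "\<dots> = b * (A * P) * Q + a * (C * Q) * P + a * b * fps_X * (P * Q)"
    by (simp add: A C a_def b_def)
  also have "fps_X * \<dots> = (bernoulli_fps * R) * \<dots>"
    by (simp add: B)
  also have "\<dots> = (bernoulli_fps * (b * A + a * C + a * b * fps_X)) * (P * Q * R)"
    by (simp add: algebra_simps)
  finally have "(A * C) * (P * Q * R)
      = (bernoulli_fps * (b * A + a * C + a * b * fps_X)) * (P * Q * R)" .
  moreover have "P * Q * R \<noteq> 0"
    using assms(2,3) fps_exp_minus_1_neq_0 by (simp add: P_def Q_def R_def)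
  ultimately have "A * C = bernoulli_fps * (b * A + a * C + a * b * fps_X)"
    using mult_right_cancel by blast
  thus ?thesis by (simp add: a_def b_def)
qed

lemma bernoulli_poly_convolution:
  fixes u v x :: real
  assumes uv: "u + v = 1" "u \<noteq> 0" "v \<noteq> 0"
  shows "(\<Sum>k=0..n. real (n choose k) * (u ^ k * v ^ (n - k)) *
            (poly (bernoulli_poly k) x * poly (bernoulli_poly (n - k)) x))
       = poly (bernoulli_poly n) x
         + (\<Sum>l=2..n. real (n choose l) * bernoulli_number l * poly (bernoulli_poly (n - l)) x *
              (v * u ^ l + u * v ^ l))"
proof -
  let ?b = "\<lambda>k. poly (bernoulli_poly k) x"
  define S where "S c = fps_const c * (fps_X :: real fps)" for c
  define F where "F = bernoulli_fps * fps_exp x"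
  define G where "G = fps_const v * (bernoulli_fps oo S u) + fps_const u * (bernoulli_fps oo S v)
                      + fps_const (u * v) * fps_X"
  have F_nth: "fps_nth F k = ?b k / fact k" for k
    by (simp add: F_def flip: bernoulli_poly_egf)
  have "F oo S c = (bernoulli_fps oo S c) * fps_exp (c * x)" for c
    by (simp add: F_def S_def fps_compose_mult_distrib)
  moreover have "fps_exp (u * x) * fps_exp (v * x) = fps_exp x"
    using uv(1) by (simp flip: fps_exp_add_mult distrib_right)
  ultimately have "(F oo S u) * (F oo S v)
      = ((bernoulli_fps oo S u) * (bernoulli_fps oo S v)) * fps_exp x"
    by (simp add: mult_ac(1) mult.left_commute[of "fps_exp (u * x)"])
  also have "\<dots> = F * G"
    unfolding S_def bernoulli_fps_addition[OF uv]
    by (simp add: F_def G_def S_def algebra_simps)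
  finally have prod: "(F oo S u) * (F oo S v) = G * F"
    by (simp add: mult.commute)
  have bernoulli_scaled: "fps_nth (bernoulli_fps oo S c) l = c ^ l * bernoulli_number l / fact l" for c l
    by (simp add: S_def fps_nth_bernoulli_fps)
  have F_scaled: "fps_nth (F oo S c) k = c ^ k * ?b k / fact k" for c k
    by (simp add: S_def F_nth)
  define c where "c l = real (n choose l) * bernoulli_number l * ?b (n - l) * (v * u ^ l + u * v ^ l)" for l
  define d where "d l = (if l = 0 then ?b n else if l = 1 then 0 else c l)" for l
  have G_nth: "fps_nth G l * fps_nth F (n - l) * fact n = d l" if "l \<le> n" for l
  proof -
    consider "l = 0" | "l = 1" | "l \<ge> 2" by linarith
    thus ?thesis
    proof cases
      case 1
      thus ?thesis using uv(1)
        by (simp add: G_def bernoulli_scaled F_nth d_def fps_nth_bernoulli_fps bernoulli_number_0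
            add.commute)
    next
      \<comment> \<open>The value \<open>B\<^sub>1 = -1/2\<close> cancels the extra term \<open>u v z\<close>.\<close>
      case 2
      thus ?thesis
        by (simp add: G_def bernoulli_scaled d_def bernoulli_number_1[simplified])
    next
      case 3
      thus ?thesis using that
        by (simp add: G_def bernoulli_scaled F_nth d_def c_def binomial_fact field_simps)
    qed
  qed
  have "(\<Sum>k=0..n. real (n choose k) * (u ^ k * v ^ (n - k)) * (?b k * ?b (n - k)))
      = fps_nth ((F oo S u) * (F oo S v)) n * fact n"
    unfolding fps_mult_nth sum_distrib_right
    by (intro sum.cong) (auto simp: F_scaled binomial_fact field_simps)
  also have "\<dots> = (\<Sum>l=0..n. d l)"
    unfolding prod fps_mult_nth sum_distrib_right by (intro sum.cong) (auto simp: G_nth)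
  also have "\<dots> = d 0 + (\<Sum>l=2..n. d l)"
  proof -
    have "(\<Sum>l=0..n. d l) = d 0 + (\<Sum>l=1..n. d l)"
      by (simp add: sum.atLeast_Suc_atMost)
    also have "(\<Sum>l=1..n. d l) = (\<Sum>l=2..n. d l)"
      by (rule sum.mono_neutral_right) (auto simp: d_def)
    finally show ?thesis .
  qed
  also have "(\<Sum>l=2..n. d l) = (\<Sum>l=2..n. c l)"
    by (intro sum.cong) (auto simp: d_def)
  finally show ?thesis by (simp add: d_def c_def)
qed

section \<open>Integration\<close>

lemma has_integral_Beta_nat:
  "((\<lambda>u::real. u ^ a * (1 - u) ^ b) has_integral fact a * fact b / fact (a + b + 1)) {0..1}"
proof -
  have "((\<lambda>t. t powr (real (a + 1) - 1) * (1 - t) powr (real (b + 1) - 1))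
      has_integral Beta (real (a + 1)) (real (b + 1))) {0..1}"
    by (rule has_integral_Beta_real) auto
  moreover have "Beta (real (a + 1)) (real (b + 1)) = fact a * fact b / fact (a + b + 1)"
    using Gamma_fact[of a, where 'a = real] Gamma_fact[of b, where 'a = real]
      Gamma_fact[of "a + b + 1", where 'a = real]
    by (simp add: Beta_def add_ac)
  ultimately have "((\<lambda>t. t powr (real (a + 1) - 1) * (1 - t) powr (real (b + 1) - 1))
      has_integral fact a * fact b / fact (a + b + 1)) (cbox 0 1)"
    by simp
  hence "((\<lambda>u::real. u ^ a * (1 - u) ^ b) has_integral fact a * fact b / fact (a + b + 1)) (cbox 0 1)"
    by (rule has_integral_spike_interior) (auto simp: powr_realpow)
  thus ?thesis by simp
qed

lemma has_integral_power_01: "((\<lambda>u::real. u ^ a) has_integral 1 / (real a + 1)) {0..1}"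
  using has_integral_Beta_nat[of a 0] by (simp add: add.commute)

lemma has_integral_power_compl_01: "((\<lambda>u::real. (1 - u) ^ b) has_integral 1 / (real b + 1)) {0..1}"
  using has_integral_Beta_nat[of 0 b] by (simp add: add.commute)

text \<open>
  The integrands below are only compared on the open interval, because the convolution identities
  need \<open>u\<close> and \<open>v = 1 - u\<close> nonzero; the end points do not affect the integral.
\<close>
lemma has_integral_unique_01:
  fixes f g :: "real \<Rightarrow> real"
  assumes "(f has_integral i) {0..1}" "(g has_integral j) {0..1}"
    and "\<And>u. 0 < u \<Longrightarrow> u < 1 \<Longrightarrow> f u = g u"
  shows "i = j"
proof -
  have "(g has_integral i) (cbox 0 1)"
    by (rule has_integral_spike_interior[of f]) (use assms in auto)
  thus ?thesis using assms(2) has_integral_unique by auto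
qed

lemma has_integral_sum_cmult:
  fixes g :: "'a \<Rightarrow> real \<Rightarrow> real"
  assumes "finite I" "\<And>i. i \<in> I \<Longrightarrow> (g i has_integral m i) S"
  shows "((\<lambda>u. \<Sum>i\<in>I. c i * g i u) has_integral (\<Sum>i\<in>I. c i * m i)) S"
  using assms by (intro has_integral_sum has_integral_mult_right)

lemma sum_bernoulli_poly_products:
  "(\<Sum>k=0..n. poly (bernoulli_poly k) x * poly (bernoulli_poly (n - k)) x)
   = real (n + 1) * poly (bernoulli_poly n) x
     + 2 * (\<Sum>l=2..n. real ((n + 1) choose (l + 1)) * bernoulli_number l / real (l + 2) *
              poly (bernoulli_poly (n - l)) x)"
proof -
  let ?b = "\<lambda>k. poly (bernoulli_poly k) x"
  let ?m = "\<lambda>a b. fact a * fact b / fact (a + b + 1) :: real"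
  let ?L = "\<Sum>k=0..n. (real (n choose k) * (?b k * ?b (n - k))) * ?m k (n - k)"
  let ?R = "?b n + (\<Sum>l=2..n. (real (n choose l) * bernoulli_number l * ?b (n - l)) * (?m l 1 + ?m 1 l))"
  have "((\<lambda>u. \<Sum>k=0..n. (real (n choose k) * (?b k * ?b (n - k))) * (u ^ k * (1 - u) ^ (n - k)))
      has_integral ?L) {0..1}"
    by (intro has_integral_sum_cmult has_integral_Beta_nat) auto
  moreover have "((\<lambda>u. ?b n + (\<Sum>l=2..n. (real (n choose l) * bernoulli_number l * ?b (n - l)) *
      (u ^ l * (1 - u) ^ 1 + u ^ 1 * (1 - u) ^ l))) has_integral ?R) {0..1}"
    using has_integral_const_real[of "?b n" 0 1]
    by (intro has_integral_add has_integral_sum_cmult has_integral_Beta_nat) auto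
  ultimately have "?L = ?R"
  proof (rule has_integral_unique_01)
    fix u :: real
    assume "0 < u" "u < 1"
    thus "(\<Sum>k=0..n. (real (n choose k) * (?b k * ?b (n - k))) * (u ^ k * (1 - u) ^ (n - k)))
        = ?b n + (\<Sum>l=2..n. (real (n choose l) * bernoulli_number l * ?b (n - l)) *
            (u ^ l * (1 - u) ^ 1 + u ^ 1 * (1 - u) ^ l))"
      using bernoulli_poly_convolution[of u "1 - u" n x] by (simp add: mult_ac)
  qed
  moreover have "real (n + 1) * ?L = (\<Sum>k=0..n. ?b k * ?b (n - k))"
    unfolding sum_distrib_left
  proof (intro sum.cong refl)
    fix k assume "k \<in> {0..n}"
    hence "real (n choose k) * ?m k (n - k) = 1 / real (n + 1)"
      by (simp add: binomial_fact)
    thus "real (n + 1) * (real (n choose k) * (?b k * ?b (n - k)) * ?m k (n - k)) = ?b k * ?b (n - k)"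
      by (simp add: field_simps)
  qed
  moreover have "real (n + 1) *
      (\<Sum>l=2..n. (real (n choose l) * bernoulli_number l * ?b (n - l)) * (?m l 1 + ?m 1 l))
    = 2 * (\<Sum>l=2..n. real ((n + 1) choose (l + 1)) * bernoulli_number l / real (l + 2) * ?b (n - l))"
    unfolding sum_distrib_left
  proof (intro sum.cong refl)
    fix l assume "l \<in> {2..n}"
    have "real (n + 1) * real (n choose l) = real ((n + 1) choose (l + 1)) * real (l + 1)"
      using Suc_times_binomial_eq[of n l]
      unfolding Suc_eq_plus1 of_nat_mult[symmetric] by (rule arg_cong)
    moreover have "fact (l + 1 + 1) = real (l + 1) * real (l + 2) * fact l"
      by (simp add: algebra_simps)
    hence "?m l 1 + ?m 1 l = 2 / (real (l + 1) * real (l + 2))"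
      by (simp del: fact_Suc add: add.commute)
    ultimately show "real (n + 1) * (real (n choose l) * bernoulli_number l * ?b (n - l) *
          (?m l 1 + ?m 1 l))
        = 2 * (real ((n + 1) choose (l + 1)) * bernoulli_number l / real (l + 2) * ?b (n - l))"
      by (simp add: divide_simps)
  qed
  ultimately show ?thesis by (simp only: distrib_left)
qed

lemma one_minus_powers_eq:
  fixes u v :: real
  assumes "u + v = 1"
  shows "1 - u ^ Suc m - v ^ Suc m = u * v * (\<Sum>i<m. u ^ i + v ^ i)"
proof -
  have uv: "1 - u = v" "1 - v = u"
    using assms by simp_all
  have "1 - u ^ m = v * (\<Sum>i<m. u ^ i)" "1 - v ^ m = u * (\<Sum>i<m. v ^ i)"
    using one_diff_power_eq[of u m] one_diff_power_eq[of v m] unfolding uv .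
  moreover have "u * v * (\<Sum>i<m. u ^ i + v ^ i) = u * (v * (\<Sum>i<m. u ^ i)) + v * (u * (\<Sum>i<m. v ^ i))"
    by (simp add: sum.distrib algebra_simps)
  ultimately have "u * v * (\<Sum>i<m. u ^ i + v ^ i) = u * (1 - u ^ m) + v * (1 - v ^ m)"
    by simp
  thus ?thesis using assms by (simp add: algebra_simps)
qed

text \<open>
  Since \<open>B\<^sub>0(x) = 1\<close>, the terms \<open>k = 0\<close> and \<open>k = n\<close> of the convolution are \<open>v\<^sup>n B\<^sub>n(x)\<close> and
  \<open>u\<^sup>n B\<^sub>n(x)\<close>; without them both sides are divisible by \<open>u v\<close>.
\<close>
lemma bernoulli_poly_convolution_divided:
  fixes u v x :: real
  assumes uv: "u + v = 1" "u \<noteq> 0" "v \<noteq> 0" and n: "n \<ge> 2"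
  shows "(\<Sum>k=1..n-1. real (n choose k) * (poly (bernoulli_poly k) x *
            poly (bernoulli_poly (n - k)) x) * (u ^ (k - 1) * v ^ (n - k - 1)))
       = poly (bernoulli_poly n) x * (\<Sum>i<n-1. u ^ i + v ^ i)
         + (\<Sum>l=2..n. real (n choose l) * bernoulli_number l * poly (bernoulli_poly (n - l)) x *
              (u ^ (l - 1) + v ^ (l - 1)))" (is "?L = ?R")
proof -
  let ?b = "\<lambda>k. poly (bernoulli_poly k) x"
  define t where "t k = real (n choose k) * (u ^ k * v ^ (n - k)) * (?b k * ?b (n - k))" for k
  have right: "(\<Sum>l=2..n. real (n choose l) * bernoulli_number l * ?b (n - l) * (v * u ^ l + u * v ^ l))
      = u * v * (\<Sum>l=2..n. real (n choose l) * bernoulli_number l * ?b (n - l) * (u ^ (l - 1) + v ^ (l - 1)))"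
    unfolding sum_distrib_left
  proof (intro sum.cong refl)
    fix l assume "l \<in> {2..n}"
    then obtain j where "l = Suc j" by (cases l) auto
    thus "real (n choose l) * bernoulli_number l * ?b (n - l) * (v * u ^ l + u * v ^ l)
      = u * v * (real (n choose l) * bernoulli_number l * ?b (n - l) * (u ^ (l - 1) + v ^ (l - 1)))"
      by (simp add: algebra_simps)
  qed
  have ends: "1 - u ^ n - v ^ n = u * v * (\<Sum>i<n-1. u ^ i + v ^ i)"
    using one_minus_powers_eq[OF uv(1), of "n - 1"] n by simp
  have "(\<Sum>k=0..n. t k) = t 0 + (\<Sum>k=1..n-1. t k) + t n"
  proof -
    have "{0..n} = insert 0 (insert n {1..n-1})" using n by auto
    thus ?thesis using n by (simp add: algebra_simps)
  qed
  moreover have "t 0 = v ^ n * ?b n" "t n = u ^ n * ?b n"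
    by (simp_all add: t_def bernoulli_poly_0)
  moreover have "(\<Sum>k=1..n-1. t k) = u * v * ?L"
    unfolding sum_distrib_left
  proof (intro sum.cong refl)
    fix k assume "k \<in> {1..n-1}"
    define i j where "i = k - 1" and "j = n - k - 1"
    have "k = Suc i" "n - k = Suc j"
      using \<open>k \<in> {1..n-1}\<close> n by (auto simp: i_def j_def)
    thus "t k = u * v * (real (n choose k) * (?b k * ?b (n - k)) * (u ^ (k - 1) * v ^ (n - k - 1)))"
      by (simp add: t_def)
  qed
  ultimately have "u * v * ?L = (1 - u ^ n - v ^ n) * ?b n
      + (\<Sum>l=2..n. real (n choose l) * bernoulli_number l * ?b (n - l) * (v * u ^ l + u * v ^ l))"
    using bernoulli_poly_convolution[OF uv, of n x] unfolding t_def left_diff_distrib by linarith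
  also have "\<dots> = u * v * ?R"
    unfolding ends right by (simp only: distrib_left mult_ac)
  finally show ?thesis using uv by simp
qed

lemma sum_bernoulli_poly_products_divided:
  assumes n: "n \<ge> 2"
  shows "(\<Sum>k=1..n-1. 1 / (real k * real (n - k)) *
            (poly (bernoulli_poly k) x * poly (bernoulli_poly (n - k)) x))
       = 2 / real n * harm (n - 1) * poly (bernoulli_poly n) x
         + 2 * (\<Sum>l=2..n. real ((n - 1) choose (l - 1)) * bernoulli_number l / (real l)\<^sup>2 *
              poly (bernoulli_poly (n - l)) x)"
proof -
  let ?b = "\<lambda>k. poly (bernoulli_poly k) x"
  let ?m = "\<lambda>a b. fact a * fact b / fact (a + b + 1) :: real"
  let ?H = "\<Sum>i<n-1. 1 / (real i + 1) + 1 / (real i + 1)"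
  let ?L = "\<Sum>k=1..n-1. (real (n choose k) * (?b k * ?b (n - k))) * ?m (k - 1) (n - k - 1)"
  let ?R = "?b n * ?H + (\<Sum>l=2..n. (real (n choose l) * bernoulli_number l * ?b (n - l)) *
      (1 / (real (l - 1) + 1) + 1 / (real (l - 1) + 1)))"
  have "((\<lambda>u. \<Sum>k=1..n-1. (real (n choose k) * (?b k * ?b (n - k))) *
      (u ^ (k - 1) * (1 - u) ^ (n - k - 1))) has_integral ?L) {0..1}"
    by (intro has_integral_sum_cmult has_integral_Beta_nat) auto
  moreover have "((\<lambda>u. ?b n * (\<Sum>i<n-1. u ^ i + (1 - u) ^ i)
      + (\<Sum>l=2..n. (real (n choose l) * bernoulli_number l * ?b (n - l)) *
          (u ^ (l - 1) + (1 - u) ^ (l - 1)))) has_integral ?R) {0..1}"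
    by (intro has_integral_add has_integral_mult_right has_integral_sum has_integral_sum_cmult
        has_integral_power_01 has_integral_power_compl_01) auto
  ultimately have eq: "?L = ?R"
  proof (rule has_integral_unique_01)
    fix u :: real
    assume "0 < u" "u < 1"
    thus "(\<Sum>k=1..n-1. (real (n choose k) * (?b k * ?b (n - k))) *
          (u ^ (k - 1) * (1 - u) ^ (n - k - 1)))
        = ?b n * (\<Sum>i<n-1. u ^ i + (1 - u) ^ i)
          + (\<Sum>l=2..n. (real (n choose l) * bernoulli_number l * ?b (n - l)) *
              (u ^ (l - 1) + (1 - u) ^ (l - 1)))"
      using n by (intro bernoulli_poly_convolution_divided) auto
  qed
  have L: "?L = real n * (\<Sum>k=1..n-1. 1 / (real k * real (n - k)) * (?b k * ?b (n - k)))"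
    unfolding sum_distrib_left
  proof (intro sum.cong refl)
    fix k assume k: "k \<in> {1..n-1}"
    define i j where "i = k - 1" and "j = n - k - 1"
    have ij: "k = Suc i" "n - k = Suc j" "n = Suc (Suc (i + j))" "k \<le> n"
      using k n by (auto simp: i_def j_def)
    have "real (n choose k) = real n * fact (i + j + 1) / (real k * fact i * (real (n - k) * fact j))"
      unfolding binomial_fact[OF ij(4)] by (simp only: ij(1-3) fact_Suc of_nat_mult) simp
    moreover have "(0::real) < fact (i + j + 1)" "(0::real) < fact i" "(0::real) < fact j"
      by (rule fact_gt_zero)+
    ultimately have "real (n choose k) * ?m i j = real n / (real k * real (n - k))"
      by (simp del: fact_Suc add: mult_ac)
    moreover have "real (n choose k) * (?b k * ?b (n - k)) * ?m i j
        = real (n choose k) * ?m i j * (?b k * ?b (n - k))"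
      by (simp only: mult_ac)
    ultimately show "real (n choose k) * (?b k * ?b (n - k)) * ?m (k - 1) (n - k - 1)
        = real n * (1 / (real k * real (n - k)) * (?b k * ?b (n - k)))"
      unfolding i_def j_def by simp
  qed
  have "(\<Sum>i<n-1. 1 / (real i + 1)) = harm (n - 1)"
    unfolding harm_altdef by (simp add: inverse_eq_divide add.commute)
  hence H: "?H = 2 * harm (n - 1)"
    unfolding sum.distrib by simp
  have R: "(\<Sum>l=2..n. (real (n choose l) * bernoulli_number l * ?b (n - l)) *
      (1 / (real (l - 1) + 1) + 1 / (real (l - 1) + 1)))
    = real n * (2 * (\<Sum>l=2..n. real ((n - 1) choose (l - 1)) * bernoulli_number l / (real l)\<^sup>2 *
        ?b (n - l)))"
    unfolding sum_distrib_left
  proof (intro sum.cong refl)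
    fix l assume l: "l \<in> {2..n}"
    have "real l * real (n choose l) = real n * real ((n - 1) choose (l - 1))"
      using times_binomial_minus1_eq[of l n] l by (simp flip: of_nat_mult)
    hence "real (n choose l) = real n * real ((n - 1) choose (l - 1)) / real l"
      using l by (simp add: field_simps)
    moreover have "real (l - 1) + 1 = real l" using l by simp
    ultimately show "real (n choose l) * bernoulli_number l * ?b (n - l) *
        (1 / (real (l - 1) + 1) + 1 / (real (l - 1) + 1))
      = real n * (2 * (real ((n - 1) choose (l - 1)) * bernoulli_number l / (real l)\<^sup>2 * ?b (n - l)))"
      by (simp add: power2_eq_square)
  qed
  show ?thesis
    using eq n unfolding L H R by (simp add: field_simps)
qed

theorem corollary1p1:
  fixes n :: nat
  assumes "n \<ge> 2"
  shows "(\<Sum>k=1..n-1. smult (1 / (real k * real (n - k)))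
            (bernoulli_poly k * bernoulli_poly (n - k)))
         - 2 * (\<Sum>l=2..n. smult (real ((n - 1) choose (l - 1)) * bernoulli_number l / (real l)\<^sup>2)
            (bernoulli_poly (n - l)))
         = smult (2 / real n * harm (n - 1)) (bernoulli_poly n)
         \<and> (\<Sum>k=0..n. bernoulli_poly k * bernoulli_poly (n - k))
         - 2 * (\<Sum>l=2..n. smult (real ((n + 1) choose (l + 1)) * bernoulli_number l / real (l + 2))
            (bernoulli_poly (n - l)))
         = smult (real (n + 1)) (bernoulli_poly n)"
proof (intro conjI poly_eq_poly_eq_iff[THEN iffD1] ext, goal_cases)
  case (1 x)
  show ?case
    using sum_bernoulli_poly_products_divided[OF assms, of x] by (simp add: poly_sum)
next
  case (2 x)
  show ?case
    using sum_bernoulli_poly_products[of x n] by (simp add: poly_sum)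
qed

end
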